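(* Let $n\ge 2$. The index $RIC$ is a continuous function of the matrix entries, i.e. $RIC: M_R\to\mathbb{R}$ is continuous, where the set $M_R$ of reciprocal matrices of order $n$ carries the topology induced from $\mathbb{R}^{n\times n}$.
   Context: $M_R$ is the set of all real $n\times n$ matrices $A=(a_{ij})$ with $a_{ij}>0$ for all $i,j$ and $a_{ij}=1/a_{ji}$ for all $i,j$ (reciprocal matrices). For $A\in M_R$ let $r_i=(a_{i1},\dots,a_{in})$ be its $i$-th row, let $\varphi_{ij}$ be the angle between $r_i$ and $r_j$, so $\cos\varphi_{ij}=\frac{r_i\cdot r_j}{|r_i|\,|r_j|}$ (Euclidean dot product and norm). The row inconsistency index is $RIC(A)=1-\frac{2\sum_{i=1}^{n-1}\sum_{j=i+1}^{n}\cos\varphi_{ij}}{n(n-1)}$. *)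

theory Defs
  imports "HOL-Analysis.Analysis"
begin

text \<open>
  The index type \<open>'n\<close> has \<open>n = CARD('n)\<close> elements. The summation over \<open>i < j\<close> needs a linear
  order on it; such types exist for every \<open>n \<ge> 1\<close> (for instance the numeral types).
\<close>

definition reciprocal_matrices :: "(real ^ 'n ^ 'n) set" where
  "reciprocal_matrices = {A. (\<forall>i j. A $ i $ j > 0) \<and> (\<forall>i j. A $ i $ j = 1 / A $ j $ i)}"

text \<open>
  For nonzero vectors the quotient lies in \<open>{-1..1}\<close> by Cauchy-Schwarz, so that its \<open>arccos\<close> is
  the angle in \<open>{0..pi}\<close>. The rows of a reciprocal matrix are nonzero.
\<close>

definition vec_angle :: "'a::real_inner \<Rightarrow> 'a \<Rightarrow> real" where
  "vec_angle x y = arccos ((x \<bullet> y) / (norm x * norm y))"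

definition RIC :: "real ^ 'n::{finite, linorder} ^ 'n::{finite, linorder} \<Rightarrow> real" where
  "RIC A = 1 - 2 * (\<Sum>i\<in>UNIV. \<Sum>j\<in>{i<..}. cos (vec_angle (row i A) (row j A)))
                 / (real CARD('n::{finite, linorder}) * (real CARD('n::{finite, linorder}) - 1))"

end

theory Submission
  imports Defs
begin

text \<open>The cosine undoes the \<open>arccos\<close>, so each summand of \<open>RIC\<close> is an
  inner product of two rows divided by the product of their norms (\<open>cos_vec_angle\<close>).
  Such a quotient is continuous wherever neither row vanishes, and positive entries rule out zero
  rows (\<open>row_reciprocal_nonzero\<close>). \<open>RIC\<close> is built from finitely many such
  quotients by sums and constants.\<close>

text \<open>Cauchy-Schwarz puts the quotient in [-1, 1]. For a zero vector the quotient is 0 by the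
  convention on division, so the equation is unconditional and can be unfolded under a
  binder.\<close>

lemma cos_vec_angle: "cos (vec_angle x y) = (x \<bullet> y) / (norm x * norm y)"
proof -
  have "\<bar>(x \<bullet> y) / (norm x * norm y)\<bar> \<le> 1"
    using Cauchy_Schwarz_ineq2[of x y] by (auto simp: abs_mult divide_le_eq_1 zero_less_mult_iff)
  then show ?thesis
    unfolding vec_angle_def by (rule cos_arccos_abs)
qed

lemma row_reciprocal_nonzero:
  assumes "A \<in> reciprocal_matrices"
  shows "row i A \<noteq> 0"
proof
  assume "row i A = 0"
  then have "A $ i $ i = 0"
    by (metis row_def vec_lambda_beta zero_index)
  moreover have "A $ i $ i > 0"
    using assms unfolding reciprocal_matrices_def by blast
  ultimately show False
    by simp
qed

lemma continuous_on_row [continuous_intros]: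
  "continuous_on S (\<lambda>A :: 'a::topological_space ^ 'n ^ 'm. row i A)"
  unfolding row_def by (intro continuous_intros)

theorem proposition10:
  assumes "CARD('n::{finite, linorder}) \<ge> 2"
  shows "continuous_on (reciprocal_matrices :: (real ^ 'n::{finite, linorder} ^ 'n::{finite, linorder}) set) RIC"
proof -
  have "continuous_on reciprocal_matrices
      (\<lambda>A :: real ^ 'n::{finite, linorder} ^ 'n::{finite, linorder}. cos (vec_angle (row i A) (row j A)))" for i j
    \<comment> \<open>With \<open>arccos\<close> gone, what remains is that the product of the norms
      is nonzero on the set.\<close>
    unfolding cos_vec_angle by (intro continuous_intros) (simp add: row_reciprocal_nonzero)
  \<comment> \<open>\<open>continuous_on_divide\<close> asks for a nonzero denominator even when it
    is constant.\<close>
  moreover have "real CARD('n::{finite, linorder}) * (real CARD('n::{finite, linorder}) - 1) \<noteq> 0"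
    using assms by simp
  ultimately show ?thesis
    unfolding RIC_def
    by (intro continuous_on_diff continuous_on_divide continuous_on_mult continuous_on_sum
        continuous_on_const) auto
qed

end
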